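(* Let $\{z_t^{ag}\}=\{(x_t^{ag},y_t^{ag})\}$ be the iterates generated by the accelerated primal-dual (APD) algorithm described in the context with $V_X(x,x_t)=\|x-x_t\|^2/2$ and $V_Y(y,y_t)=\|y-y_t\|^2/2$. Assume that the parameters $\beta_t,\theta_t,\eta_t,\tau_t$ satisfy $\beta_1=1$ and, for all $t\ge1$ (the second condition for all $t\ge2$) and for some $0<p<1$, $$\beta_{t+1}-1=\beta_t\theta_{t+1},$$ $$\theta_t=\frac{\eta_{t-1}}{\eta_t}=\frac{\tau_{t-1}}{\tau_t},$$ $$\frac{\alpha_X}{\eta_t}-\frac{L_G}{\beta_t}-\frac{L_K^2\tau_t}{p\,\alpha_Y}\ge0,$$ where $\alpha_X=\alpha_Y=1$. Let $(\hat x,\hat y)$ be a pair of solutions (saddle point) of the saddle point problem and $$D:=\sqrt{\|\hat x-x_1\|^2+\frac{\eta_1}{\tau_1}\|\hat y-y_1\|^2}.$$ Then for any $t\ge1$ there exists a perturbation vector $v_{t+1}$ such that $$\tilde g(z_{t+1}^{ag},v_{t+1})\le\frac{(2-p)D^2}{\beta_t\eta_t(1-p)}$$ and moreover $$\|v_{t+1}\|\le\frac1{\beta_t\eta_t}\|\hat x-x_1\|+\frac1{\beta_t\tau_t}\|\hat y-y_1\|+\left[\frac1{\beta_t\eta_t}\left(1+\sqrt{\frac{\eta_1}{\tau_1(1-p)}}\right)+\frac{2L_K}{\beta_t}\right]D .$$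
   Context: Setting. $\mathcal X,\mathcal Y$ are finite-dimensional real vector spaces, each with an inner product $\langle\cdot,\cdot\rangle$ and, here (Euclidean setting), $\|\cdot\|$ the associated norm; $X\subseteq\mathcal X$, $Y\subseteq\mathcal Y$ are closed convex sets (possibly unbounded), $Z=X\times Y$, with $\langle(x,y),(x',y')\rangle=\langle x,x'\rangle+\langle y,y'\rangle$ and $\|(x,y)\|^2=\|x\|^2+\|y\|^2$. $G$ is a smooth convex function with $G(y)-G(x)-\langle\nabla G(x),y-x\rangle\le\frac{L_G}{2}\|y-x\|^2$ for all $x,y\in X$, for some $L_G\ge0$. $K:\mathcal X\to\mathcal Y$ is linear with transpose $K^T$ and operator norm $L_K=\|K\|$. $J:Y\to\mathbb R$ is proper, convex and lower semicontinuous. The saddle point problem is $\min_{x\in X}\max_{y\in Y}G(x)+\langle Kx,y\rangle-J(y)$, which is assumed to have a saddle point. APD algorithm. Choose $x_1\in X$, $y_1\in Y$; set $x_1^{ag}=x_1$, $y_1^{ag}=y_1$, $\bar x_1=x_1$. With positive stepsizes $\eta_t,\tau_t$, for $t=1,2,\dots$: $x_t^{md}=(1-\beta_t^{-1})x_t^{ag}+\beta_t^{-1}x_t$; $y_{t+1}=\operatorname{argmin}_{y\in Y}\langle-K\bar x_t,y\rangle+J(y)+\frac1{\tau_t}V_Y(y,y_t)$; $x_{t+1}=\operatorname{argmin}_{x\in X}\langle\nabla G(x_t^{md}),x\rangle+\langle x,K^Ty_{t+1}\rangle+\frac1{\eta_t}V_X(x,x_t)$; $x_{t+1}^{ag}=(1-\beta_t^{-1})x_t^{ag}+\beta_t^{-1}x_{t+1}$;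 $y_{t+1}^{ag}=(1-\beta_t^{-1})y_t^{ag}+\beta_t^{-1}y_{t+1}$; $\bar x_{t+1}=\theta_{t+1}(x_{t+1}-x_t)+x_{t+1}$. In general $V_X,V_Y$ are Bregman divergences of functions with strong convexity parameters $\alpha_X,\alpha_Y$; for the Euclidean choice used here $\alpha_X=\alpha_Y=1$. Gap functions. For $\tilde z=(\tilde x,\tilde y)$, $z=(x,y)\in Z$: $Q(\tilde z,z)=[G(\tilde x)+\langle K\tilde x,y\rangle-J(y)]-[G(x)+\langle Kx,\tilde y\rangle-J(\tilde y)]$. A point $\hat z\in Z$ is a solution (saddle point) iff $Q(\hat z,z)\le0$ for all $z\in Z$. For $v\in\mathcal X\times\mathcal Y$, $\tilde g(\tilde z,v)=\max_{z\in Z}\{Q(\tilde z,z)-\langle v,\tilde z-z\rangle\}$ (understood as a supremum). *)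

theory Defs
  imports "HOL-Analysis.Analysis"
begin

definition lower_semicontinuous_on :: "'a::topological_space set \<Rightarrow> ('a \<Rightarrow> real) \<Rightarrow> bool" where
  "lower_semicontinuous_on S f \<longleftrightarrow>
     (\<forall>x\<in>S. \<forall>c<f x. eventually (\<lambda>u. c < f u) (at x within S))"

(* The derivative is taken relative to X, so G need not be defined in a neighbourhood of X.  If G is
   differentiable on an open superset of X, its usual gradient is a possible gradG. *)
definition smooth_convex_on ::
  "'a::euclidean_space set \<Rightarrow> ('a \<Rightarrow> real) \<Rightarrow> ('a \<Rightarrow> 'a) \<Rightarrow> real \<Rightarrow> bool" where
  "smooth_convex_on X G gradG L \<longleftrightarrow>
     convex_on X G \<and>
     (\<forall>x\<in>X. (G has_derivative (\<lambda>h. gradG x \<bullet> h)) (at x within X)) \<and>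
     0 \<le> L \<and>
     (\<forall>x\<in>X. \<forall>y\<in>X. G y - G x - gradG x \<bullet> (y - x) \<le> L / 2 * (norm (y - x))\<^sup>2)"

definition Q_gap ::
  "('a \<Rightarrow> real) \<Rightarrow> ('a \<Rightarrow> 'b::euclidean_space) \<Rightarrow> ('b \<Rightarrow> real) \<Rightarrow> 'a \<times> 'b \<Rightarrow> 'a \<times> 'b \<Rightarrow> real" where
  "Q_gap G K J z' z =
     (G (fst z') + K (fst z') \<bullet> snd z - J (snd z)) - (G (fst z) + K (fst z) \<bullet> snd z' - J (snd z'))"

definition saddle_point ::
  "'a set \<Rightarrow> 'b set \<Rightarrow> ('a \<Rightarrow> real) \<Rightarrow> ('a \<Rightarrow> 'b::euclidean_space) \<Rightarrow> ('b \<Rightarrow> real) \<Rightarrow> 'a \<times> 'b \<Rightarrow> bool" where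
  "saddle_point X Y G K J z' \<longleftrightarrow> z' \<in> X \<times> Y \<and> (\<forall>z\<in>X \<times> Y. Q_gap G K J z' z \<le> 0)"

(* Extended-real valued, because the supremum over the possibly unbounded X \<times> Y may be infinite. *)
definition perturbed_gap ::
  "'a::euclidean_space set \<Rightarrow> 'b::euclidean_space set \<Rightarrow> ('a \<Rightarrow> real) \<Rightarrow> ('a \<Rightarrow> 'b) \<Rightarrow> ('b \<Rightarrow> real)
     \<Rightarrow> 'a \<times> 'b \<Rightarrow> 'a \<times> 'b \<Rightarrow> ereal" where
  "perturbed_gap X Y G K J z' v = (SUP z\<in>X \<times> Y. ereal (Q_gap G K J z' z - v \<bullet> (z' - z)))"

(* The sequences x, y, xag, yag, xmd, xbar (indexed from 1; the value at 0 is irrelevant) form a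
   run of the accelerated primal-dual algorithm with prox-functions VX, VY. *)
definition apd_run ::
  "'a::euclidean_space set \<Rightarrow> 'b::euclidean_space set \<Rightarrow> ('a \<Rightarrow> 'a) \<Rightarrow> ('a \<Rightarrow> 'b) \<Rightarrow> ('b \<Rightarrow> real)
     \<Rightarrow> ('a \<Rightarrow> 'a \<Rightarrow> real) \<Rightarrow> ('b \<Rightarrow> 'b \<Rightarrow> real)
     \<Rightarrow> (nat \<Rightarrow> real) \<Rightarrow> (nat \<Rightarrow> real) \<Rightarrow> (nat \<Rightarrow> real) \<Rightarrow> (nat \<Rightarrow> real)
     \<Rightarrow> (nat \<Rightarrow> 'a) \<Rightarrow> (nat \<Rightarrow> 'b) \<Rightarrow> (nat \<Rightarrow> 'a) \<Rightarrow> (nat \<Rightarrow> 'b) \<Rightarrow> (nat \<Rightarrow> 'a) \<Rightarrow> (nat \<Rightarrow> 'a) \<Rightarrow> bool" where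
  "apd_run X Y gradG K J VX VY \<beta> \<theta> \<eta> \<tau> x y xag yag xmd xbar \<longleftrightarrow>
     x 1 \<in> X \<and> y 1 \<in> Y \<and> xag 1 = x 1 \<and> yag 1 = y 1 \<and> xbar 1 = x 1 \<and>
     (\<forall>t\<ge>1.
        xmd t = (1 - inverse (\<beta> t)) *\<^sub>R xag t + inverse (\<beta> t) *\<^sub>R x t \<and>
        is_arg_min (\<lambda>u. - K (xbar t) \<bullet> u + J u + 1 / \<tau> t * VY u (y t)) (\<lambda>u. u \<in> Y) (y (t + 1)) \<and>
        is_arg_min (\<lambda>u. gradG (xmd t) \<bullet> u + u \<bullet> adjoint K (y (t + 1)) + 1 / \<eta> t * VX u (x t))
          (\<lambda>u. u \<in> X) (x (t + 1)) \<and>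
        xag (t + 1) = (1 - inverse (\<beta> t)) *\<^sub>R xag t + inverse (\<beta> t) *\<^sub>R x (t + 1) \<and>
        yag (t + 1) = (1 - inverse (\<beta> t)) *\<^sub>R yag t + inverse (\<beta> t) *\<^sub>R y (t + 1) \<and>
        xbar (t + 1) = \<theta> (t + 1) *\<^sub>R (x (t + 1) - x t) + x (t + 1))"

end

theory Submission
  imports Defs
begin

text \<open>
  The proof is a potential argument.  The condition on \<open>\<theta>\<close> makes \<open>\<kappa> = \<eta> t / \<tau> t\<close> independent of \<open>t\<close> and,
  together with the recursion for \<open>\<beta>\<close>, gives \<open>(\<beta> (t + 1) - 1) * \<eta> (t + 1) = \<beta> t * \<eta> t\<close>.  Hence, if the
  bound on one iteration is multiplied by \<open>\<eta> t\<close>, the gap at the averaged iterates telescopes, and so do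
  the squared distances to a comparison point \<open>z\<close>.  The extrapolated point \<open>xbar\<close> is chosen so that the
  bilinear coupling terms \<open>K (x (t + 1) - x t) \<bullet> (snd z - y (t + 1))\<close> telescope as well, up to an error
  that Young's inequality splits between the step in \<open>x\<close> and the step in \<open>y\<close>; the stepsize condition
  absorbs both parts.  The outcome is \<open>gap_plus_potential_le\<close>.

  Two consequences are drawn from this one inequality.  With the saddle point as \<open>z\<close> the gap is
  nonnegative, so that every iterate, and every average of iterates, lies in the ellipsoid
  \<open>(norm (xhat - u))\<^sup>2 + \<kappa> * (1 - p) * (norm (yhat - w))\<^sup>2 \<le> D\<^sup>2\<close>, although the feasible set may be
  unbounded.  For a general \<open>z\<close> the upper bound on the gap is affine in \<open>z\<close>, because a difference of
  two squared distances is affine.  Its linear part is the perturbation \<open>v\<close>; what remains is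
  the value of the bound at the averaged iterate itself, and the ellipsoid controls both this value and
  the norm of \<open>v\<close>.
\<close>

section \<open>Convexity in Euclidean spaces\<close>

lemma norm_sq_convex_combination:
  fixes a b :: "'a::real_inner"
  shows "(norm ((1 - s) *\<^sub>R a + s *\<^sub>R b))\<^sup>2
    = (1 - s) * (norm a)\<^sup>2 + s * (norm b)\<^sup>2 - s * (1 - s) * (norm (a - b))\<^sup>2"
  unfolding power2_norm_eq_inner
  by (simp add: inner_add_left inner_add_right inner_diff_left inner_diff_right inner_commute
      algebra_simps)

lemma norm_sq_convex_combination_le:
  fixes a b c :: "'a::real_inner"
  assumes "0 \<le> s" "s \<le> 1"
  shows "(norm (c - ((1 - s) *\<^sub>R a + s *\<^sub>R b)))\<^sup>2
    \<le> (1 - s) * (norm (c - a))\<^sup>2 + s * (norm (c - b))\<^sup>2"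
proof -
  have "c - ((1 - s) *\<^sub>R a + s *\<^sub>R b) = (1 - s) *\<^sub>R (c - a) + s *\<^sub>R (c - b)"
    by (simp add: algebra_simps)
  moreover have "0 \<le> s * (1 - s) * (norm ((c - a) - (c - b)))\<^sup>2"
    using assms by simp
  ultimately show ?thesis
    using norm_sq_convex_combination[of s "c - a" "c - b"] by simp
qed

lemma norm_diff_sq_le_via:
  fixes a b c :: "'a::real_inner"
  shows "(norm (a - b))\<^sup>2 \<le> 2 * ((norm (c - a))\<^sup>2 + (norm (c - b))\<^sup>2)"
proof -
  have "0 \<le> (norm ((c - a) + (c - b)))\<^sup>2" by simp
  then show ?thesis
    unfolding power2_norm_eq_inner
    by (simp add: inner_add_left inner_add_right inner_diff_left inner_diff_right inner_commute)
qed

text \<open>As a function of \<open>c\<close>, the difference of two squared distances has no quadratic part, so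
  its increment between \<open>e\<close> and \<open>c\<close> is linear.\<close>

lemma norm_sq_diff_affine:
  fixes a b c e :: "'a::real_inner"
  shows "(norm (c - a))\<^sup>2 - (norm (c - b))\<^sup>2
    = (norm (e - a))\<^sup>2 - (norm (e - b))\<^sup>2 + 2 * ((a - b) \<bullet> (e - c))"
  unfolding power2_norm_eq_inner
  by (simp add: inner_add_left inner_add_right inner_diff_left inner_diff_right inner_commute
      algebra_simps)

text \<open>The derivative is one-sided (relative to \<open>S\<close>), and \<open>a\<close> may be a boundary point.  Only difference
  quotients along the segment from \<open>a\<close> to \<open>b\<close> enter; convexity bounds each of them by \<open>f b - f a\<close>.\<close>

lemma convex_on_above_gradient:
  fixes f :: "'a::euclidean_space \<Rightarrow> real"
  assumes f: "convex_on S f" and a: "a \<in> S" and b: "b \<in> S"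
    and deriv: "(f has_derivative (\<lambda>h. g \<bullet> h)) (at a within S)"
  shows "f a + g \<bullet> (b - a) \<le> f b"
proof -
  define \<phi> where "\<phi> s = f (a + s *\<^sub>R (b - a))" for s :: real
  have conv: "convex S" using f by (simp add: convex_on_def)
  have seg: "(\<lambda>s. a + s *\<^sub>R (b - a)) ` {0..1} \<subseteq> S"
  proof clarify
    fix s :: real assume "s \<in> {0..1}"
    then have "(1 - s) *\<^sub>R a + s *\<^sub>R b \<in> S" using conv a b by (simp add: convex_alt)
    then show "a + s *\<^sub>R (b - a) \<in> S" by (simp add: algebra_simps)
  qed
  have "((\<lambda>s. a + s *\<^sub>R (b - a)) has_derivative (\<lambda>s. s *\<^sub>R (b - a))) (at 0 within {0..1::real})"
    by (auto intro!: derivative_eq_intros)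
  moreover have "(f has_derivative (\<lambda>h. g \<bullet> h))
      (at (a + 0 *\<^sub>R (b - a)) within (\<lambda>s. a + s *\<^sub>R (b - a)) ` {0..1})"
    using has_derivative_subset[OF deriv seg] by simp
  ultimately have "(\<phi> has_derivative (\<lambda>s. g \<bullet> (s *\<^sub>R (b - a)))) (at 0 within {0..1})"
    unfolding \<phi>_def by (rule has_derivative_in_compose)
  moreover have "(\<lambda>s. g \<bullet> (s *\<^sub>R (b - a))) = (*) (g \<bullet> (b - a))"
    by (simp add: fun_eq_iff)
  ultimately have "(\<phi> has_real_derivative g \<bullet> (b - a)) (at 0 within {0..1})"
    by (simp add: has_field_derivative_def)
  then have lim: "((\<lambda>s. (\<phi> s - \<phi> 0) / s) \<longlongrightarrow> g \<bullet> (b - a)) (at 0 within {0..1})"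
    by (simp add: has_field_derivative_iff)
  have "\<forall>\<^sub>F s in at 0 within {0..1}. (\<phi> s - \<phi> 0) / s \<le> f b - f a"
    unfolding eventually_at_filter
  proof (intro always_eventually allI impI)
    fix s :: real assume "s \<noteq> 0" "s \<in> {0..1}"
    then have s: "0 < s" "s \<le> 1" by auto
    have "f ((1 - s) *\<^sub>R a + s *\<^sub>R b) \<le> (1 - s) * f a + s * f b"
      using convex_onD[OF f] s a b by simp
    moreover have "(1 - s) *\<^sub>R a + s *\<^sub>R b = a + s *\<^sub>R (b - a)" by (simp add: algebra_simps)
    ultimately have "\<phi> s - \<phi> 0 \<le> s * (f b - f a)" by (simp add: \<phi>_def algebra_simps)
    then show "(\<phi> s - \<phi> 0) / s \<le> f b - f a" using s by (simp add: field_simps)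
  qed
  moreover have "at (0::real) within {0..1} \<noteq> bot"
    by (simp add: at_within_Icc_at_right)
  ultimately show ?thesis using tendsto_upperbound[OF lim] by fastforce
qed

text \<open>The proximal objective is strongly convex, which is where the term in \<open>norm (u - m)\<close> comes from.
  Since \<open>f\<close> need not be differentiable, optimality is exploited by comparing \<open>m\<close> with
  points of the segment from \<open>m\<close> to \<open>u\<close> and letting them tend to \<open>m\<close>.\<close>

lemma prox_three_point:
  fixes f :: "'a::euclidean_space \<Rightarrow> real"
  assumes f: "convex_on S f"
    and min: "is_arg_min (\<lambda>u. f u + c * ((norm (u - w))\<^sup>2 / 2)) (\<lambda>u. u \<in> S) m"
    and u: "u \<in> S"
  shows "f m - f u \<le> c / 2 * ((norm (u - w))\<^sup>2 - (norm (m - w))\<^sup>2 - (norm (u - m))\<^sup>2)"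
proof -
  have conv: "convex S" using f by (simp add: convex_on_def)
  have m: "m \<in> S" and le: "\<And>u. u \<in> S \<Longrightarrow>
      f m + c * ((norm (m - w))\<^sup>2 / 2) \<le> f u + c * ((norm (u - w))\<^sup>2 / 2)"
    using min by (auto simp: is_arg_min_linorder)
  define A where "A = f u - f m + c / 2 * ((norm (u - w))\<^sup>2 - (norm (m - w))\<^sup>2)"
  define B where "B = c / 2 * (norm (u - m))\<^sup>2"
  have "z * B \<le> A" if z: "0 < z" "z < 1" for z :: real
  proof -
    define s where "s = 1 - z"
    have s: "0 < s" "s < 1" using z by (auto simp: s_def)
    define q where "q = (1 - s) *\<^sub>R m + s *\<^sub>R u"
    have "q \<in> S" using conv m u s by (simp add: q_def convex_alt)
    have fq: "f q \<le> (1 - s) * f m + s * f u"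
      unfolding q_def using convex_onD[OF f] s m u by simp
    have "q - w = (1 - s) *\<^sub>R (m - w) + s *\<^sub>R (u - w)"
      by (simp add: q_def algebra_simps)
    then have "(norm (q - w))\<^sup>2 = (1 - s) * (norm (m - w))\<^sup>2 + s * (norm (u - w))\<^sup>2
        - s * (1 - s) * (norm (u - m))\<^sup>2"
      by (simp only: norm_sq_convex_combination) (simp add: norm_minus_commute)
    then have "f m + c * ((norm (m - w))\<^sup>2 / 2) \<le> (1 - s) * f m + s * f u
        + c * (((1 - s) * (norm (m - w))\<^sup>2 + s * (norm (u - w))\<^sup>2
        - s * (1 - s) * (norm (u - m))\<^sup>2) / 2)"
      using le[OF \<open>q \<in> S\<close>] fq by simp
    then have "0 \<le> s * (A - (1 - s) * B)"
      by (simp add: A_def B_def field_simps)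
    then show ?thesis using s by (simp add: zero_le_mult_iff s_def)
  qed
  then have "B \<le> A" by (rule field_le_mult_one_interval)
  then show ?thesis by (simp add: A_def B_def algebra_simps)
qed

lemma young_bilinear:
  fixes K :: "'a::euclidean_space \<Rightarrow> 'b::euclidean_space"
  assumes "linear K" and c: "0 < c"
  shows "K d \<bullet> e \<le> (onorm K)\<^sup>2 / (2 * c) * (norm d)\<^sup>2 + c / 2 * (norm e)\<^sup>2"
proof -
  have "K d \<bullet> e \<le> norm (K d) * norm e" by (rule norm_cauchy_schwarz)
  also have "\<dots> \<le> (onorm K * norm d) * norm e"
    using onorm[of K d] assms by (intro mult_right_mono) (auto simp: linear_linear)
  also have "\<dots> \<le> (onorm K)\<^sup>2 / (2 * c) * (norm d)\<^sup>2 + c / 2 * (norm e)\<^sup>2"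
  proof -
    have "0 \<le> (onorm K * norm d - c * norm e)\<^sup>2 / (2 * c)" using c by simp
    also have "\<dots> = (onorm K)\<^sup>2 / (2 * c) * (norm d)\<^sup>2 + c / 2 * (norm e)\<^sup>2
        - (onorm K * norm d) * norm e"
      using c by (simp add: power2_eq_square field_simps)
    finally show ?thesis by simp
  qed
  finally show ?thesis .
qed

lemma Q_gap_antisym: "Q_gap G K J z' z = - Q_gap G K J z z'"
  by (simp add: Q_gap_def)

section \<open>One iteration of the accelerated primal-dual algorithm\<close>

locale apd_setting =
  fixes X :: "'a::euclidean_space set" and Y :: "'b::euclidean_space set"
    and G :: "'a \<Rightarrow> real" and gradG :: "'a \<Rightarrow> 'a" and L\<^sub>G :: real
    and K :: "'a \<Rightarrow> 'b" and L\<^sub>K :: real and J :: "'b \<Rightarrow> real"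
    and \<beta> \<theta> \<eta> \<tau> :: "nat \<Rightarrow> real"
    and x xag xmd xbar :: "nat \<Rightarrow> 'a" and y yag :: "nat \<Rightarrow> 'b"
    and p :: real
  assumes smooth: "smooth_convex_on X G gradG L\<^sub>G"
    and linK: "linear K" and L\<^sub>K: "L\<^sub>K = onorm K"
    and convJ: "convex_on Y J"
    and eta_pos: "t \<ge> 1 \<Longrightarrow> \<eta> t > 0" and tau_pos: "t \<ge> 1 \<Longrightarrow> \<tau> t > 0"
    and run: "apd_run X Y gradG K J (\<lambda>u w. (norm (u - w))\<^sup>2 / 2) (\<lambda>u w. (norm (u - w))\<^sup>2 / 2)
           \<beta> \<theta> \<eta> \<tau> x y xag yag xmd xbar"
    and p_pos: "0 < p" and p_less_1: "p < 1"
    and beta_1: "\<beta> 1 = 1"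
    and beta_step: "t \<ge> 1 \<Longrightarrow> \<beta> (t + 1) - 1 = \<beta> t * \<theta> (t + 1)"
    and theta_eta: "t \<ge> 2 \<Longrightarrow> \<theta> t = \<eta> (t - 1) / \<eta> t"
    and theta_tau: "t \<ge> 2 \<Longrightarrow> \<theta> t = \<tau> (t - 1) / \<tau> t"
    and stepsize: "t \<ge> 1 \<Longrightarrow> 1 / \<eta> t - L\<^sub>G / \<beta> t - L\<^sub>K\<^sup>2 * \<tau> t / p \<ge> 0"
begin

definition \<kappa> :: real where "\<kappa> = \<eta> 1 / \<tau> 1"

lemma kappa_pos: "\<kappa> > 0"
  using eta_pos[of 1] tau_pos[of 1] by (simp add: \<kappa>_def)

lemma eta_eq: "t \<ge> 1 \<Longrightarrow> \<eta> t = \<kappa> * \<tau> t"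
proof (induction t rule: dec_induct)
  case base
  then show ?case using tau_pos[of 1] by (simp add: \<kappa>_def)
next
  case (step t)
  have "\<eta> t / \<eta> (Suc t) = \<tau> t / \<tau> (Suc t)"
    using theta_eta[of "Suc t"] theta_tau[of "Suc t"] step by simp
  then show ?case
    using step eta_pos[of t] eta_pos[of "Suc t"] tau_pos[of t] tau_pos[of "Suc t"] kappa_pos
    by (simp add: field_simps)
qed

lemma theta_pos: "t \<ge> 2 \<Longrightarrow> \<theta> t > 0"
  using theta_eta[of t] eta_pos[of t] eta_pos[of "t - 1"] by simp

lemma beta_ge_1: "t \<ge> 1 \<Longrightarrow> \<beta> t \<ge> 1"
proof (induction t rule: dec_induct)
  case base
  then show ?case using beta_1 by simp
next
  case (step t)
  have "0 \<le> \<beta> t * \<theta> (Suc t)" using step theta_pos[of "Suc t"] by (intro mult_nonneg_nonneg) auto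
  then show ?case using beta_step[of t] step by simp
qed

lemma beta_eta_telescope: "t \<ge> 1 \<Longrightarrow> (\<beta> (t + 1) - 1) * \<eta> (t + 1) = \<beta> t * \<eta> t"
  using beta_step[of t] theta_eta[of "t + 1"] eta_pos[of "t + 1"] by simp

lemma convX: "convex X" and convG: "convex_on X G"
  using smooth by (auto simp: smooth_convex_on_def convex_on_def)

lemma convY: "convex Y"
  using convJ by (simp add: convex_on_def)

lemma run_init: "x 1 \<in> X" "y 1 \<in> Y" "xag 1 = x 1" "yag 1 = y 1" "xbar 1 = x 1"
  using run by (auto simp: apd_run_def)

lemma run_step:
  assumes "t \<ge> 1"
  shows "xmd t = (1 - inverse (\<beta> t)) *\<^sub>R xag t + inverse (\<beta> t) *\<^sub>R x t"
    and "is_arg_min (\<lambda>u. (- K (xbar t) \<bullet> u + J u) + 1 / \<tau> t * ((norm (u - y t))\<^sup>2 / 2))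
           (\<lambda>u. u \<in> Y) (y (t + 1))"
    and "is_arg_min (\<lambda>u. (gradG (xmd t) \<bullet> u + u \<bullet> adjoint K (y (t + 1)))
             + 1 / \<eta> t * ((norm (u - x t))\<^sup>2 / 2)) (\<lambda>u. u \<in> X) (x (t + 1))"
    and "xag (t + 1) = (1 - inverse (\<beta> t)) *\<^sub>R xag t + inverse (\<beta> t) *\<^sub>R x (t + 1)"
    and "yag (t + 1) = (1 - inverse (\<beta> t)) *\<^sub>R yag t + inverse (\<beta> t) *\<^sub>R y (t + 1)"
    and "xbar (t + 1) = \<theta> (t + 1) *\<^sub>R (x (t + 1) - x t) + x (t + 1)"
  using run assms unfolding apd_run_def by blast+

lemma inverse_beta: "t \<ge> 1 \<Longrightarrow> 0 < inverse (\<beta> t)" "t \<ge> 1 \<Longrightarrow> inverse (\<beta> t) \<le> 1"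
  using beta_ge_1[of t] by (auto simp: field_simps)

lemma iterates_feasible:
  "t \<ge> 1 \<Longrightarrow> x t \<in> X \<and> y t \<in> Y \<and> xag t \<in> X \<and> yag t \<in> Y"
proof (induction t rule: dec_induct)
  case base
  then show ?case using run_init by simp
next
  case (step t)
  have "x (t + 1) \<in> X" "y (t + 1) \<in> Y"
    using run_step(2,3)[OF step(1)] by (auto simp: is_arg_min_def)
  moreover have "xag (t + 1) \<in> X" "yag (t + 1) \<in> Y"
    using run_step(4,5)[OF step(1)] inverse_beta[OF step(1)] convX convY step calculation
    by (auto simp: convex_alt)
  ultimately show ?case by simp
qed

lemma xmd_feasible: "t \<ge> 1 \<Longrightarrow> xmd t \<in> X"
  using run_step(1)[of t] inverse_beta[of t] convX iterates_feasible[of t] by (auto simp: convex_alt)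

text \<open>The averaged iterate and the middle point differ by \<open>inverse (\<beta> t) *\<^sub>R (x (t + 1) - x t)\<close>.  This is the
  point of evaluating the gradient at \<open>xmd\<close>: after multiplication by \<open>\<beta> t\<close>, the quadratic error of the
  smooth part carries a factor \<open>1 / \<beta> t\<close> only.\<close>

lemma smooth_part_step:
  assumes t: "t \<ge> 1" and u: "u \<in> X"
  shows "\<beta> t * G (xag (t + 1)) \<le> (\<beta> t - 1) * G (xag t) + G u
    + gradG (xmd t) \<bullet> (x (t + 1) - u) + L\<^sub>G / (2 * \<beta> t) * (norm (x (t + 1) - x t))\<^sup>2"
proof -
  have b: "\<beta> t \<ge> 1" using beta_ge_1[OF t] .
  let ?g = "gradG (xmd t)" and ?b = "\<beta> t"
  have md: "xmd t \<in> X" using xmd_feasible[OF t] .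
  have mem: "x t \<in> X" "xag t \<in> X" "xag (t + 1) \<in> X"
    using iterates_feasible[of t] iterates_feasible[of "t + 1"] t by auto
  have der: "(G has_derivative (\<lambda>h. ?g \<bullet> h)) (at (xmd t) within X)"
    using smooth md by (auto simp: smooth_convex_on_def)
  have below: "G (xmd t) + ?g \<bullet> (w - xmd t) \<le> G w" if "w \<in> X" for w
    using convex_on_above_gradient[OF convG md that der] .
  have d: "xag (t + 1) - xmd t = inverse ?b *\<^sub>R (x (t + 1) - x t)"
    unfolding run_step(1)[OF t] run_step(4)[OF t] by (simp add: algebra_simps)
  have "G (xag (t + 1)) - G (xmd t) - ?g \<bullet> (xag (t + 1) - xmd t)
      \<le> L\<^sub>G / 2 * (norm (xag (t + 1) - xmd t))\<^sup>2"
    using smooth md mem by (auto simp: smooth_convex_on_def)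
  also have "(norm (xag (t + 1) - xmd t))\<^sup>2 = (inverse ?b)\<^sup>2 * (norm (x (t + 1) - x t))\<^sup>2"
    unfolding d using b by (simp add: power_mult_distrib)
  finally have "G (xag (t + 1)) \<le> G (xmd t) + ?g \<bullet> (xag (t + 1) - xmd t)
      + L\<^sub>G / 2 * ((inverse ?b)\<^sup>2 * (norm (x (t + 1) - x t))\<^sup>2)" by simp
  then have "?b * G (xag (t + 1)) \<le> ?b * (G (xmd t) + ?g \<bullet> (xag (t + 1) - xmd t)
      + L\<^sub>G / 2 * ((inverse ?b)\<^sup>2 * (norm (x (t + 1) - x t))\<^sup>2))"
    using b by (intro mult_left_mono) auto
  also have "\<dots> = ?b * (G (xmd t) + ?g \<bullet> (xag (t + 1) - xmd t))
      + L\<^sub>G / (2 * ?b) * (norm (x (t + 1) - x t))\<^sup>2"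
    using b by (simp add: field_simps power2_eq_square)
  also have "?b * (G (xmd t) + ?g \<bullet> (xag (t + 1) - xmd t))
      = (?b - 1) * (G (xmd t) + ?g \<bullet> (xag t - xmd t)) + (G (xmd t) + ?g \<bullet> (u - xmd t))
        + ?g \<bullet> (x (t + 1) - u)"
  proof -
    have "?b *\<^sub>R xag (t + 1) = (?b - 1) *\<^sub>R xag t + x (t + 1)"
      unfolding run_step(4)[OF t] using b by (simp add: algebra_simps)
    then have "?b * (?g \<bullet> xag (t + 1)) = (?b - 1) * (?g \<bullet> xag t) + ?g \<bullet> x (t + 1)"
      by (metis inner_add_right inner_scaleR_right)
    then show ?thesis by (simp add: inner_diff_right algebra_simps)
  qed
  also have "\<dots> \<le> (?b - 1) * G (xag t) + G u + ?g \<bullet> (x (t + 1) - u)"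
    using below[OF mem(2)] below[OF u] b by (intro add_mono mult_left_mono) auto
  finally show ?thesis by simp
qed

lemma dual_average_step:
  assumes t: "t \<ge> 1"
  shows "\<beta> t * J (yag (t + 1)) \<le> (\<beta> t - 1) * J (yag t) + J (y (t + 1))"
proof -
  have b: "\<beta> t \<ge> 1" using beta_ge_1[OF t] .
  have "J (yag (t + 1)) \<le> (1 - inverse (\<beta> t)) * J (yag t) + inverse (\<beta> t) * J (y (t + 1))"
    unfolding run_step(5)[OF t]
    using convex_onD[OF convJ] inverse_beta[OF t] iterates_feasible[of t]
      iterates_feasible[of "t + 1"] t by simp
  then have "\<beta> t * J (yag (t + 1))
      \<le> \<beta> t * ((1 - inverse (\<beta> t)) * J (yag t) + inverse (\<beta> t) * J (y (t + 1)))"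
    using b by (intro mult_left_mono) auto
  also have "\<dots> = (\<beta> t - 1) * J (yag t) + J (y (t + 1))"
    using b by (simp add: field_simps)
  finally show ?thesis .
qed

lemma primal_prox_step:
  assumes t: "t \<ge> 1" and u: "u \<in> X"
  shows "gradG (xmd t) \<bullet> (x (t + 1) - u) + K (x (t + 1) - u) \<bullet> y (t + 1)
    \<le> 1 / (2 * \<eta> t) * ((norm (u - x t))\<^sup>2 - (norm (x (t + 1) - x t))\<^sup>2 - (norm (u - x (t + 1)))\<^sup>2)"
proof -
  have "convex_on X (\<lambda>u. gradG (xmd t) \<bullet> u + u \<bullet> adjoint K (y (t + 1)))"
    using convX by (intro convex_onI) (auto simp: inner_add_left inner_add_right algebra_simps)
  from prox_three_point[OF this run_step(3)[OF t] u] show ?thesis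
    by (simp add: adjoint_works[OF linK] inner_diff_left inner_diff_right linear_diff[OF linK])
qed

lemma dual_prox_step:
  assumes t: "t \<ge> 1" and w: "w \<in> Y"
  shows "- K (xbar t) \<bullet> (y (t + 1) - w) + J (y (t + 1)) - J w
    \<le> 1 / (2 * \<tau> t) * ((norm (w - y t))\<^sup>2 - (norm (y (t + 1) - y t))\<^sup>2 - (norm (w - y (t + 1)))\<^sup>2)"
proof -
  have "convex_on Y (\<lambda>u. - K (xbar t) \<bullet> u)"
    using convY by (intro convex_onI) (auto simp: inner_add_right algebra_simps)
  then have "convex_on Y (\<lambda>u. - K (xbar t) \<bullet> u + J u)" using convJ by (rule convex_on_add)
  from prox_three_point[OF this run_step(2)[OF t] w] show ?thesis
    by (simp add: inner_diff_right)
qed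

text \<open>The vector \<open>e\<close> is the extrapolation \<open>xbar t - x t\<close>, and \<open>K e\<close> enters twice: against \<open>snd z - y t\<close>,
  where it cancels the coupling term left by the previous iteration, and in the last term, which is
  the price of replacing \<open>y (t + 1)\<close> by \<open>y t\<close> there.  Young's inequality is used with weight \<open>p / \<tau> t\<close>, so that
  the dual prox term \<open>(norm (y (t + 1) - y t))\<^sup>2 / (2 * \<tau> t)\<close> pays for it, as \<open>p < 1\<close>; the stepsize condition
  leaves the term in \<open>norm (x (t + 1) - x t)\<close> to pay for the same error in the next iteration.\<close>

lemma gap_step:
  fixes z :: "'a \<times> 'b"
  assumes t: "t \<ge> 1" and z: "z \<in> X \<times> Y"
  defines "e \<equiv> xbar t - x t"
  shows "\<beta> t * Q_gap G K J (xag (t + 1), yag (t + 1)) z - (\<beta> t - 1) * Q_gap G K J (xag t, yag t) z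
    \<le> 1 / (2 * \<eta> t) * ((norm (fst z - x t))\<^sup>2 - (norm (fst z - x (t + 1)))\<^sup>2)
      + 1 / (2 * \<tau> t) * ((norm (snd z - y t))\<^sup>2 - (norm (snd z - y (t + 1)))\<^sup>2)
      + K (x (t + 1) - x t) \<bullet> (snd z - y (t + 1)) - L\<^sub>K\<^sup>2 * \<tau> t / (2 * p) * (norm (x (t + 1) - x t))\<^sup>2
      - K e \<bullet> (snd z - y t) + L\<^sub>K\<^sup>2 * \<tau> t / (2 * p) * (norm e)\<^sup>2"
proof -
  obtain u w where zuw: "z = (u, w)" and u: "u \<in> X" and w: "w \<in> Y" using z by auto
  have b: "\<beta> t \<ge> 1" using beta_ge_1[OF t] .
  note pos = eta_pos[OF t] tau_pos[OF t] p_pos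
  let ?d = "x (t + 1) - x t"
  have xagK: "\<beta> t * (K (xag (t + 1)) \<bullet> w) = (\<beta> t - 1) * (K (xag t) \<bullet> w) + K (x (t + 1)) \<bullet> w"
    unfolding run_step(4)[OF t] using b
    by (simp add: linear_add[OF linK] linear_cmul[OF linK] inner_add_left field_simps)
  have yagK: "\<beta> t * (K u \<bullet> yag (t + 1)) = (\<beta> t - 1) * (K u \<bullet> yag t) + K u \<bullet> y (t + 1)"
    unfolding run_step(5)[OF t] using b by (simp add: inner_add_right field_simps)
  have gap: "\<beta> t * Q_gap G K J (xag (t + 1), yag (t + 1)) z - (\<beta> t - 1) * Q_gap G K J (xag t, yag t) z
      \<le> gradG (xmd t) \<bullet> (x (t + 1) - u) + L\<^sub>G / (2 * \<beta> t) * (norm ?d)\<^sup>2 + J (y (t + 1)) - J w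
        + K (x (t + 1)) \<bullet> w - K u \<bullet> y (t + 1)"
    using smooth_part_step[OF t u] dual_average_step[OF t] xagK yagK
    by (simp add: Q_gap_def zuw algebra_simps)
  have bil: "K (x (t + 1)) \<bullet> w - K u \<bullet> y (t + 1) - K (x (t + 1) - u) \<bullet> y (t + 1)
      + K (xbar t) \<bullet> (y (t + 1) - w)
      = K ?d \<bullet> (w - y (t + 1)) - K e \<bullet> (w - y t) + K e \<bullet> (y (t + 1) - y t)"
    by (simp add: e_def linear_diff[OF linK] inner_diff_left inner_diff_right)
  have young: "K e \<bullet> (y (t + 1) - y t)
      \<le> L\<^sub>K\<^sup>2 * \<tau> t / (2 * p) * (norm e)\<^sup>2 + 1 / (2 * \<tau> t) * (norm (y (t + 1) - y t))\<^sup>2"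
  proof -
    have "K e \<bullet> (y (t + 1) - y t) \<le> L\<^sub>K\<^sup>2 / (2 * (p / \<tau> t)) * (norm e)\<^sup>2
        + (p / \<tau> t) / 2 * (norm (y (t + 1) - y t))\<^sup>2"
      unfolding L\<^sub>K using pos by (intro young_bilinear linK) auto
    moreover have "(p / \<tau> t) / 2 * (norm (y (t + 1) - y t))\<^sup>2
        \<le> 1 / (2 * \<tau> t) * (norm (y (t + 1) - y t))\<^sup>2"
      using pos p_less_1 by (intro mult_right_mono) (auto simp: field_simps)
    ultimately show ?thesis using pos by simp
  qed
  have half: "a / (2 * c) = a / c / 2" for a c :: real by simp
  have halves: "a / 2 \<le> b / 2 - c / 2" if "0 \<le> b - a - c" for a b c :: real using that by simp
  have "L\<^sub>G / (2 * \<beta> t) \<le> 1 / (2 * \<eta> t) - L\<^sub>K\<^sup>2 * \<tau> t / (2 * p)"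
    unfolding half by (rule halves[OF stepsize[OF t]])
  then have step: "L\<^sub>G / (2 * \<beta> t) * (norm ?d)\<^sup>2
      \<le> 1 / (2 * \<eta> t) * (norm ?d)\<^sup>2 - L\<^sub>K\<^sup>2 * \<tau> t / (2 * p) * (norm ?d)\<^sup>2"
    unfolding left_diff_distrib[symmetric] by (rule mult_right_mono) simp
  show ?thesis
    using gap bil young step primal_prox_step[OF t u] dual_prox_step[OF t w]
    by (simp add: zuw right_diff_distrib)
qed

section \<open>The telescoped bound\<close>

definition potential :: "nat \<Rightarrow> 'a \<times> 'b \<Rightarrow> real" where
  "potential t z = (norm (fst z - x (t + 1)))\<^sup>2 / 2 + \<kappa> / 2 * (norm (snd z - y (t + 1)))\<^sup>2
    - \<eta> t * (K (x (t + 1) - x t) \<bullet> (snd z - y (t + 1)))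
    + \<eta> t * \<tau> t * L\<^sub>K\<^sup>2 / (2 * p) * (norm (x (t + 1) - x t))\<^sup>2"

lemma scaled_gap_step:
  assumes t: "t \<ge> 1" and z: "z \<in> X \<times> Y"
  shows "\<beta> t * \<eta> t * Q_gap G K J (xag (t + 1), yag (t + 1)) z + potential t z
    \<le> (\<beta> t - 1) * \<eta> t * Q_gap G K J (xag t, yag t) z
      + (norm (fst z - x t))\<^sup>2 / 2 + \<kappa> / 2 * (norm (snd z - y t))\<^sup>2
      - \<eta> t * (K (xbar t - x t) \<bullet> (snd z - y t))
      + \<eta> t * \<tau> t * L\<^sub>K\<^sup>2 / (2 * p) * (norm (xbar t - x t))\<^sup>2"
proof -
  note pos = eta_pos[OF t] tau_pos[OF t]
  have k: "\<eta> t / \<tau> t = \<kappa>" using eta_eq[OF t] pos by simp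
  have k2: "\<eta> t * (1 / (2 * \<tau> t) * r) = \<kappa> / 2 * r" for r
    by (simp flip: k)
  have k1: "\<eta> t * (1 / (2 * \<eta> t) * r) = r / 2" for r
    using pos by simp
  have "\<eta> t * (\<beta> t * Q_gap G K J (xag (t + 1), yag (t + 1)) z - (\<beta> t - 1) * Q_gap G K J (xag t, yag t) z)
    \<le> \<eta> t * (1 / (2 * \<eta> t) * ((norm (fst z - x t))\<^sup>2 - (norm (fst z - x (t + 1)))\<^sup>2)
      + 1 / (2 * \<tau> t) * ((norm (snd z - y t))\<^sup>2 - (norm (snd z - y (t + 1)))\<^sup>2)
      + K (x (t + 1) - x t) \<bullet> (snd z - y (t + 1)) - L\<^sub>K\<^sup>2 * \<tau> t / (2 * p) * (norm (x (t + 1) - x t))\<^sup>2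
      - K (xbar t - x t) \<bullet> (snd z - y t) + L\<^sub>K\<^sup>2 * \<tau> t / (2 * p) * (norm (xbar t - x t))\<^sup>2)"
    using gap_step[OF t z] pos by (intro mult_left_mono) auto
  then show ?thesis
    unfolding distrib_left[of "\<eta> t"] right_diff_distrib[of "\<eta> t"] k1 k2
    by (simp add: potential_def algebra_simps diff_divide_distrib)
qed

text \<open>In the first iteration \<open>\<beta> 1 - 1 = 0\<close> removes the old gap, and \<open>xbar 1 = x 1\<close> the extrapolation terms.
  Later \<open>xbar t - x t\<close> is \<open>\<theta> t\<close> times the previous step, and \<open>\<eta> t * \<theta> t = \<eta> (t - 1)\<close> turns the
  right-hand side of \<open>scaled_gap_step\<close> into the previous left-hand side.\<close>

lemma gap_plus_potential_le:
  assumes z: "z \<in> X \<times> Y"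
  shows "t \<ge> 1 \<Longrightarrow> \<beta> t * \<eta> t * Q_gap G K J (xag (t + 1), yag (t + 1)) z + potential t z
    \<le> (norm (fst z - x 1))\<^sup>2 / 2 + \<kappa> / 2 * (norm (snd z - y 1))\<^sup>2"
proof (induction t rule: dec_induct)
  case base
  then show ?case
    using scaled_gap_step[OF order_refl z] beta_1 run_init(5) linear_0[OF linK] by simp
next
  case (step t)
  let ?t = "t + 1" and ?d = "x (t + 1) - x t"
  have "\<eta> ?t * \<theta> ?t = \<eta> t" using theta_eta[of ?t] eta_pos[of ?t] step by simp
  moreover have "\<tau> ?t * \<theta> ?t = \<tau> t" using theta_tau[of ?t] tau_pos[of ?t] step by simp
  ultimately have th: "\<eta> ?t * \<theta> ?t = \<eta> t" "\<tau> ?t * \<theta> ?t = \<tau> t" .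
  have e: "xbar ?t - x ?t = \<theta> ?t *\<^sub>R ?d" using run_step(6)[of t] step by simp
  have e1: "\<eta> ?t * (K (xbar ?t - x ?t) \<bullet> (snd z - y ?t)) = \<eta> t * (K ?d \<bullet> (snd z - y ?t))"
    unfolding e linear_cmul[OF linK] using th by (simp flip: th(1) add: mult.assoc)
  have "\<eta> ?t * \<tau> ?t * L\<^sub>K\<^sup>2 / (2 * p) * (norm (xbar ?t - x ?t))\<^sup>2
      = (\<eta> ?t * \<theta> ?t) * (\<tau> ?t * \<theta> ?t) * L\<^sub>K\<^sup>2 / (2 * p) * (norm ?d)\<^sup>2"
    unfolding e by (simp add: power_mult_distrib power2_eq_square)
  then have e2: "\<eta> ?t * \<tau> ?t * L\<^sub>K\<^sup>2 / (2 * p) * (norm (xbar ?t - x ?t))\<^sup>2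
      = \<eta> t * \<tau> t * L\<^sub>K\<^sup>2 / (2 * p) * (norm ?d)\<^sup>2"
    unfolding th .
  have "\<beta> ?t * \<eta> ?t * Q_gap G K J (xag (?t + 1), yag (?t + 1)) z + potential ?t z
      \<le> \<beta> t * \<eta> t * Q_gap G K J (xag (t + 1), yag (t + 1)) z + potential t z"
    using scaled_gap_step[of ?t, OF _ z, unfolded e1 e2 beta_eta_telescope[OF step(1)]]
    by (simp add: potential_def[of t])
  then show ?case using step by simp
qed

lemma coupling_young:
  assumes t: "t \<ge> 1"
  shows "\<eta> t * (K (x (t + 1) - x t) \<bullet> w)
    \<le> \<eta> t * \<tau> t * L\<^sub>K\<^sup>2 / (2 * p) * (norm (x (t + 1) - x t))\<^sup>2 + \<kappa> * p / 2 * (norm w)\<^sup>2"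
proof -
  note pos = eta_pos[OF t] tau_pos[OF t] p_pos
  have "\<eta> t * (K (x (t + 1) - x t) \<bullet> w)
      \<le> \<eta> t * (L\<^sub>K\<^sup>2 / (2 * (p / \<tau> t)) * (norm (x (t + 1) - x t))\<^sup>2 + (p / \<tau> t) / 2 * (norm w)\<^sup>2)"
    unfolding L\<^sub>K using pos by (intro mult_left_mono young_bilinear linK) auto
  also have "\<dots> = \<eta> t * \<tau> t * L\<^sub>K\<^sup>2 / (2 * p) * (norm (x (t + 1) - x t))\<^sup>2
      + (\<eta> t / \<tau> t) * p / 2 * (norm w)\<^sup>2"
    by (simp add: algebra_simps)
  also have "\<eta> t / \<tau> t = \<kappa>" using eta_eq[OF t] pos by simp
  finally show ?thesis .
qed

section \<open>Boundedness and the perturbation vector\<close>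

text \<open>The gap of any feasible point against a saddle point is nonnegative and can be dropped from
  \<open>gap_plus_potential_le\<close>.  In the potential that remains, Young's inequality trades the coupling term for
  the fraction \<open>p\<close> of the dual distance, which explains the weight \<open>1 - p\<close>.\<close>

lemma iterates_in_ellipsoid:
  assumes saddle: "saddle_point X Y G K J (xhat, yhat)" and t: "t \<ge> 1"
  shows "(norm (xhat - x t))\<^sup>2 + \<kappa> * (1 - p) * (norm (yhat - y t))\<^sup>2
    \<le> (norm (xhat - x 1))\<^sup>2 + \<kappa> * (norm (yhat - y 1))\<^sup>2"
proof (cases "t = 1")
  case True
  have "\<kappa> * (1 - p) \<le> \<kappa>" using kappa_pos p_pos by (simp add: algebra_simps)
  then have "\<kappa> * (1 - p) * (norm (yhat - y 1))\<^sup>2 \<le> \<kappa> * (norm (yhat - y 1))\<^sup>2"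
    by (rule mult_right_mono) simp
  then show ?thesis using True by simp
next
  case False
  define s where "s = t - 1"
  have s: "s \<ge> 1" "t = s + 1" using t False by (auto simp: s_def)
  have zhat: "(xhat, yhat) \<in> X \<times> Y"
    and le0: "Q_gap G K J (xhat, yhat) (xag (s + 1), yag (s + 1)) \<le> 0"
    using saddle iterates_feasible[of "s + 1"] by (auto simp: saddle_point_def)
  have "0 \<le> \<beta> s * \<eta> s * Q_gap G K J (xag (s + 1), yag (s + 1)) (xhat, yhat)"
    using le0 Q_gap_antisym[of G K J "(xhat, yhat)"] beta_ge_1[OF s(1)] eta_pos[OF s(1)]
    by (intro mult_nonneg_nonneg) auto
  then have "potential s (xhat, yhat)
      \<le> (norm (xhat - x 1))\<^sup>2 / 2 + \<kappa> / 2 * (norm (yhat - y 1))\<^sup>2"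
    using gap_plus_potential_le[OF zhat s(1)] by simp
  then show ?thesis
    using coupling_young[OF s(1), of "yhat - y (s + 1)"]
    unfolding s(2) potential_def fst_conv snd_conv by (simp add: algebra_simps)
qed

lemma averages_in_ellipsoid:
  assumes saddle: "saddle_point X Y G K J (xhat, yhat)"
  shows "t \<ge> 1 \<Longrightarrow> (norm (xhat - xag t))\<^sup>2 + \<kappa> * (1 - p) * (norm (yhat - yag t))\<^sup>2
    \<le> (norm (xhat - x 1))\<^sup>2 + \<kappa> * (norm (yhat - y 1))\<^sup>2"
proof (induction t rule: dec_induct)
  case base
  then show ?case using iterates_in_ellipsoid[OF saddle, of 1] run_init by simp
next
  case (step t)
  let ?b = "inverse (\<beta> t)" and ?c = "\<kappa> * (1 - p)"
    and ?R = "(norm (xhat - x 1))\<^sup>2 + \<kappa> * (norm (yhat - y 1))\<^sup>2"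
  have b: "0 \<le> ?b" "?b \<le> 1" using inverse_beta[OF step(1)] by auto
  have c: "0 \<le> ?c" using kappa_pos p_less_1 by simp
  have "(norm (xhat - xag (t + 1)))\<^sup>2 + ?c * (norm (yhat - yag (t + 1)))\<^sup>2
      \<le> ((1 - ?b) * (norm (xhat - xag t))\<^sup>2 + ?b * (norm (xhat - x (t + 1)))\<^sup>2)
        + ?c * ((1 - ?b) * (norm (yhat - yag t))\<^sup>2 + ?b * (norm (yhat - y (t + 1)))\<^sup>2)"
    unfolding run_step(4,5)[OF step(1)]
    by (intro add_mono mult_left_mono norm_sq_convex_combination_le b c)
  also have "\<dots> = (1 - ?b) * ((norm (xhat - xag t))\<^sup>2 + ?c * (norm (yhat - yag t))\<^sup>2)
      + ?b * ((norm (xhat - x (t + 1)))\<^sup>2 + ?c * (norm (yhat - y (t + 1)))\<^sup>2)"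
    by (simp add: algebra_simps)
  also have "\<dots> \<le> (1 - ?b) * ?R + ?b * ?R"
    using step iterates_in_ellipsoid[OF saddle, of "t + 1"] b
    by (intro add_mono[OF mult_left_mono mult_left_mono]) auto
  also have "\<dots> = ?R" by (simp add: algebra_simps)
  finally show ?case by simp
qed

text \<open>The linear part, in the comparison point \<open>z\<close>, of the bound \<open>gap_plus_potential_le\<close>.\<close>

definition perturbation :: "nat \<Rightarrow> 'a \<times> 'b" where
  "perturbation t = ((1 / (\<beta> t * \<eta> t)) *\<^sub>R (x 1 - x (t + 1)),
    (1 / (\<beta> t * \<tau> t)) *\<^sub>R (y 1 - y (t + 1)) - (1 / \<beta> t) *\<^sub>R K (x (t + 1) - x t))"

text \<open>Subtracting the linear part amounts to evaluating the bound at the averaged iterate in place of \<open>z\<close>.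
  There the quadratic terms of the potential dominate its coupling term, by Young's inequality and
  \<open>p < 1\<close>, so that only the squared distances to the starting point survive.\<close>

lemma perturbed_Q_gap_le:
  assumes t: "t \<ge> 1" and z: "z \<in> X \<times> Y"
  shows "Q_gap G K J (xag (t + 1), yag (t + 1)) z
      - perturbation t \<bullet> ((xag (t + 1), yag (t + 1)) - z)
    \<le> ((norm (xag (t + 1) - x 1))\<^sup>2 + \<kappa> * (norm (yag (t + 1) - y 1))\<^sup>2) / (2 * (\<beta> t * \<eta> t))"
proof -
  obtain u w where zuw: "z = (u, w)" by (cases z)
  have b: "\<beta> t > 0" using beta_ge_1[OF t] by linarith
  note pos = eta_pos[OF t] tau_pos[OF t] b
  let ?a = "xag (t + 1)" and ?c = "yag (t + 1)" and ?d = "x (t + 1) - x t"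
  have k: "\<eta> t / \<tau> t = \<kappa>" using eta_eq[OF t] pos by simp
  define v where "v = perturbation t \<bullet> ((?a, ?c) - z)"
  have v: "\<beta> t * \<eta> t * v = (x 1 - x (t + 1)) \<bullet> (?a - u) + \<kappa> * ((y 1 - y (t + 1)) \<bullet> (?c - w))
      - \<eta> t * (K ?d \<bullet> (?c - w))"
  proof -
    have "\<beta> t * \<eta> t * v = (\<beta> t * \<eta> t) * (1 / (\<beta> t * \<eta> t)) * ((x 1 - x (t + 1)) \<bullet> (?a - u))
        + (\<beta> t * \<eta> t) * (1 / (\<beta> t * \<tau> t)) * ((y 1 - y (t + 1)) \<bullet> (?c - w))
        - (\<beta> t * \<eta> t) * (1 / \<beta> t) * (K ?d \<bullet> (?c - w))"
      unfolding v_def perturbation_def zuw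
      by (simp add: inner_diff_left right_diff_distrib distrib_left)
    also have "(\<beta> t * \<eta> t) * (1 / (\<beta> t * \<eta> t)) = 1" using pos by simp
    also have "(\<beta> t * \<eta> t) * (1 / (\<beta> t * \<tau> t)) = \<kappa>" using pos by (simp flip: k)
    also have "(\<beta> t * \<eta> t) * (1 / \<beta> t) = \<eta> t" using pos by simp
    finally show ?thesis by simp
  qed
  have "\<kappa> * p / 2 * (norm (?c - y (t + 1)))\<^sup>2 \<le> \<kappa> / 2 * (norm (?c - y (t + 1)))\<^sup>2"
    using kappa_pos p_less_1 by (intro mult_right_mono) auto
  then have couple: "\<eta> t * (K ?d \<bullet> (?c - y (t + 1)))
      \<le> \<eta> t * \<tau> t * L\<^sub>K\<^sup>2 / (2 * p) * (norm ?d)\<^sup>2 + \<kappa> / 2 * (norm (?c - y (t + 1)))\<^sup>2"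
    using coupling_young[OF t, of "?c - y (t + 1)"] by linarith
  have split: "\<eta> t * (K ?d \<bullet> (w - y (t + 1)))
      = \<eta> t * (K ?d \<bullet> (?c - y (t + 1))) - \<eta> t * (K ?d \<bullet> (?c - w))"
    by (simp add: inner_diff_right algebra_simps)
  have yaff: "\<kappa> / 2 * (norm (w - y 1))\<^sup>2 - \<kappa> / 2 * (norm (w - y (t + 1)))\<^sup>2
      = \<kappa> / 2 * (norm (?c - y 1))\<^sup>2 - \<kappa> / 2 * (norm (?c - y (t + 1)))\<^sup>2
        + \<kappa> * ((y 1 - y (t + 1)) \<bullet> (?c - w))"
    using arg_cong[OF norm_sq_diff_affine[of w "y 1" "y (t + 1)" ?c], of "\<lambda>r. \<kappa> / 2 * r"]
    by (simp add: algebra_simps)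
  have "\<beta> t * \<eta> t * Q_gap G K J (?a, ?c) z + potential t z
      \<le> (norm (u - x 1))\<^sup>2 / 2 + \<kappa> / 2 * (norm (w - y 1))\<^sup>2"
    using gap_plus_potential_le[OF z t] by (simp add: zuw)
  moreover have "0 \<le> (norm (?a - x (t + 1)))\<^sup>2" by simp
  ultimately have "\<beta> t * \<eta> t * Q_gap G K J (?a, ?c) z - \<beta> t * \<eta> t * v
      \<le> (norm (?a - x 1))\<^sup>2 / 2 + \<kappa> / 2 * (norm (?c - y 1))\<^sup>2"
    using couple split yaff norm_sq_diff_affine[of u "x 1" "x (t + 1)" ?a]
    unfolding v potential_def zuw fst_conv snd_conv by argo
  then have "(Q_gap G K J (?a, ?c) z - v) * (\<beta> t * \<eta> t)
      \<le> (norm (?a - x 1))\<^sup>2 / 2 + \<kappa> / 2 * (norm (?c - y 1))\<^sup>2"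
    by (simp add: algebra_simps)
  then have "Q_gap G K J (?a, ?c) z - v
      \<le> ((norm (?a - x 1))\<^sup>2 / 2 + \<kappa> / 2 * (norm (?c - y 1))\<^sup>2) / (\<beta> t * \<eta> t)"
    using pos by (simp only: pos_le_divide_eq mult_pos_pos)
  also have "\<dots> = ((norm (?a - x 1))\<^sup>2 + \<kappa> * (norm (?c - y 1))\<^sup>2) / (2 * (\<beta> t * \<eta> t))"
    by (simp add: field_simps)
  finally show ?thesis by (simp add: v_def)
qed

lemma norm_perturbation_le:
  assumes t: "t \<ge> 1"
  shows "norm (perturbation t) \<le> 1 / (\<beta> t * \<eta> t) * norm (x 1 - x (t + 1))
    + 1 / (\<beta> t * \<tau> t) * norm (y 1 - y (t + 1)) + L\<^sub>K / \<beta> t * norm (x (t + 1) - x t)"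
proof -
  have b: "\<beta> t > 0" using beta_ge_1[OF t] by linarith
  note pos = eta_pos[OF t] tau_pos[OF t] b
  have "norm (K (x (t + 1) - x t)) \<le> L\<^sub>K * norm (x (t + 1) - x t)"
    unfolding L\<^sub>K using linK by (intro onorm) (simp add: linear_linear)
  then have Kd: "norm ((1 / \<beta> t) *\<^sub>R K (x (t + 1) - x t)) \<le> L\<^sub>K / \<beta> t * norm (x (t + 1) - x t)"
    using b by (simp add: field_simps)
  have "norm (perturbation t) \<le> norm ((1 / (\<beta> t * \<eta> t)) *\<^sub>R (x 1 - x (t + 1)))
      + norm ((1 / (\<beta> t * \<tau> t)) *\<^sub>R (y 1 - y (t + 1)) - (1 / \<beta> t) *\<^sub>R K (x (t + 1) - x t))"
    unfolding perturbation_def by (rule norm_Pair_le)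
  also have "\<dots> \<le> norm ((1 / (\<beta> t * \<eta> t)) *\<^sub>R (x 1 - x (t + 1)))
      + (norm ((1 / (\<beta> t * \<tau> t)) *\<^sub>R (y 1 - y (t + 1))) + L\<^sub>K / \<beta> t * norm (x (t + 1) - x t))"
    by (intro add_left_mono order_trans[OF norm_triangle_ineq4] Kd)
  finally show ?thesis using pos by simp
qed

end

section \<open>The convergence bounds\<close>

theorem theorem2p3:
  fixes X :: "'a::euclidean_space set" and Y :: "'b::euclidean_space set"
    and G :: "'a \<Rightarrow> real" and gradG :: "'a \<Rightarrow> 'a" and L\<^sub>G :: real
    and K :: "'a \<Rightarrow> 'b" and L\<^sub>K :: real and J :: "'b \<Rightarrow> real"
    and \<beta> \<theta> \<eta> \<tau> :: "nat \<Rightarrow> real"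
    and x xag xmd xbar :: "nat \<Rightarrow> 'a" and y yag :: "nat \<Rightarrow> 'b"
    and p D :: real and xhat :: 'a and yhat :: 'b
  assumes "closed X" "convex X" "closed Y" "convex Y"
    and "smooth_convex_on X G gradG L\<^sub>G"
    and "linear K" and "L\<^sub>K = onorm K"
    and "convex_on Y J" and "lower_semicontinuous_on Y J"
    and "\<And>t. t \<ge> 1 \<Longrightarrow> \<eta> t > 0" and "\<And>t. t \<ge> 1 \<Longrightarrow> \<tau> t > 0"
    and "apd_run X Y gradG K J (\<lambda>u w. (norm (u - w))\<^sup>2 / 2) (\<lambda>u w. (norm (u - w))\<^sup>2 / 2)
           \<beta> \<theta> \<eta> \<tau> x y xag yag xmd xbar"
    and "0 < p" "p < 1"
    and "\<beta> 1 = 1"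
    and "\<And>t. t \<ge> 1 \<Longrightarrow> \<beta> (t + 1) - 1 = \<beta> t * \<theta> (t + 1)"
    and "\<And>t. t \<ge> 2 \<Longrightarrow> \<theta> t = \<eta> (t - 1) / \<eta> t"
    and "\<And>t. t \<ge> 2 \<Longrightarrow> \<theta> t = \<tau> (t - 1) / \<tau> t"
    and "\<And>t. t \<ge> 1 \<Longrightarrow> 1 / \<eta> t - L\<^sub>G / \<beta> t - L\<^sub>K\<^sup>2 * \<tau> t / p \<ge> 0"
    and "saddle_point X Y G K J (xhat, yhat)"
    and "D = sqrt ((norm (xhat - x 1))\<^sup>2 + \<eta> 1 / \<tau> 1 * (norm (yhat - y 1))\<^sup>2)"
  shows "\<forall>t\<ge>1. \<exists>v.
           perturbed_gap X Y G K J (xag (t + 1), yag (t + 1)) v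
             \<le> ereal ((2 - p) * D\<^sup>2 / (\<beta> t * \<eta> t * (1 - p))) \<and>
           norm v \<le> 1 / (\<beta> t * \<eta> t) * norm (xhat - x 1) + 1 / (\<beta> t * \<tau> t) * norm (yhat - y 1)
             + (1 / (\<beta> t * \<eta> t) * (1 + sqrt (\<eta> 1 / (\<tau> 1 * (1 - p)))) + 2 * L\<^sub>K / \<beta> t) * D"
proof (intro allI impI)
  fix t :: nat assume t: "t \<ge> 1"
  interpret apd_setting X Y G gradG L\<^sub>G K L\<^sub>K J \<beta> \<theta> \<eta> \<tau> x xag xmd xbar y yag p
    by (rule apd_setting.intro) (fact assms)+
  note saddle = \<open>saddle_point X Y G K J (xhat, yhat)\<close>
  have b: "\<beta> t > 0" using beta_ge_1[OF t] by linarith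
  note pos = eta_pos[OF t] tau_pos[OF t] b kappa_pos
  have "0 \<le> (norm (xhat - x 1))\<^sup>2 + \<kappa> * (norm (yhat - y 1))\<^sup>2"
    using kappa_pos by simp
  then have D2: "D\<^sup>2 = (norm (xhat - x 1))\<^sup>2 + \<kappa> * (norm (yhat - y 1))\<^sup>2"
    and D0: "0 \<le> D"
    unfolding \<open>D = _\<close> \<kappa>_def by (rule real_sqrt_pow2, rule real_sqrt_ge_zero)
  have q: "0 < 1 - p" using p_less_1 by simp
  have c: "0 < \<kappa> * (1 - p)" using kappa_pos q by simp
  let ?a = "xag (t + 1)" and ?c = "yag (t + 1)" and ?B = "\<beta> t * \<eta> t"

  have near: "norm (xhat - x s) \<le> D" if "s \<ge> 1" for s
  proof (rule power2_le_imp_le[OF _ D0])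
    have "0 \<le> \<kappa> * (1 - p) * (norm (yhat - y s))\<^sup>2" using c by simp
    then show "(norm (xhat - x s))\<^sup>2 \<le> D\<^sup>2"
      using iterates_in_ellipsoid[OF saddle that] D2 by linarith
  qed
  \<comment> \<open>The factor \<open>\<kappa>\<close> is there because \<open>1 / (\<beta> t * \<tau> t) = \<kappa> / (\<beta> t * \<eta> t)\<close>.\<close>
  have neary: "\<kappa> * norm (yhat - y (t + 1)) \<le> sqrt (\<eta> 1 / (\<tau> 1 * (1 - p))) * D"
  proof -
    have "\<kappa> * (1 - p) * (norm (yhat - y (t + 1)))\<^sup>2 \<le> D\<^sup>2"
      using iterates_in_ellipsoid[OF saddle, of "t + 1"] D2 zero_le_power2[of "norm (xhat - x (t + 1))"]
      by linarith
    then have "\<kappa> / (1 - p) * (\<kappa> * (1 - p) * (norm (yhat - y (t + 1)))\<^sup>2) \<le> \<kappa> / (1 - p) * D\<^sup>2"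
      using kappa_pos q by (intro mult_left_mono) auto
    then have "(\<kappa> * norm (yhat - y (t + 1)))\<^sup>2 \<le> \<kappa> / (1 - p) * D\<^sup>2"
      using q by (simp add: power_mult_distrib power2_eq_square mult_ac)
    then have "\<kappa> * norm (yhat - y (t + 1)) \<le> sqrt (\<kappa> / (1 - p) * D\<^sup>2)"
      by (rule real_le_rsqrt)
    also have "\<dots> = sqrt (\<kappa> / (1 - p)) * D" using D0 by (simp only: real_sqrt_mult real_sqrt_abs abs_of_nonneg)
    also have "\<kappa> / (1 - p) = \<eta> 1 / (\<tau> 1 * (1 - p))" by (simp add: \<kappa>_def)
    finally show ?thesis .
  qed

  have at_average: "(norm (?a - x 1))\<^sup>2 + \<kappa> * (norm (?c - y 1))\<^sup>2 \<le> 2 * ((2 - p) * D\<^sup>2 / (1 - p))"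
  proof -
    let ?E = "(norm (xhat - ?a))\<^sup>2 + \<kappa> * (norm (yhat - ?c))\<^sup>2"
    \<comment> \<open>The ellipsoid weighs the dual distance with \<open>\<kappa> * (1 - p)\<close> instead of \<open>\<kappa>\<close>; restoring the weight
      costs the factor \<open>1 / (1 - p)\<close>.\<close>
    have "(1 - p) * ?E \<le> (norm (xhat - ?a))\<^sup>2 + \<kappa> * (1 - p) * (norm (yhat - ?c))\<^sup>2"
      using p_pos by (simp add: algebra_simps)
    also have "\<dots> \<le> D\<^sup>2" using averages_in_ellipsoid[OF saddle, of "t + 1"] D2 by simp
    finally have E: "?E \<le> D\<^sup>2 / (1 - p)" using q by (simp add: pos_le_divide_eq mult.commute)
    have "(norm (?a - x 1))\<^sup>2 + \<kappa> * (norm (?c - y 1))\<^sup>2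
        \<le> 2 * ((norm (xhat - ?a))\<^sup>2 + (norm (xhat - x 1))\<^sup>2)
          + \<kappa> * (2 * ((norm (yhat - ?c))\<^sup>2 + (norm (yhat - y 1))\<^sup>2))"
      using kappa_pos by (intro add_mono mult_left_mono norm_diff_sq_le_via) auto
    also have "\<dots> = 2 * (?E + D\<^sup>2)" by (simp add: D2 algebra_simps)
    also have "\<dots> \<le> 2 * (D\<^sup>2 / (1 - p) + D\<^sup>2)" using E by simp
    also have "D\<^sup>2 / (1 - p) + D\<^sup>2 = (2 - p) * D\<^sup>2 / (1 - p)"
      using q by (simp add: field_simps)
    finally show ?thesis .
  qed
  have gap: "perturbed_gap X Y G K J (?a, ?c) (perturbation t)
      \<le> ereal ((2 - p) * D\<^sup>2 / (?B * (1 - p)))"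
    unfolding perturbed_gap_def
  proof (rule SUP_least)
    fix z assume z: "z \<in> X \<times> Y"
    have "Q_gap G K J (?a, ?c) z - perturbation t \<bullet> ((?a, ?c) - z)
        \<le> ((norm (?a - x 1))\<^sup>2 + \<kappa> * (norm (?c - y 1))\<^sup>2) / (2 * ?B)"
      by (rule perturbed_Q_gap_le[OF t z])
    also have "\<dots> \<le> 2 * ((2 - p) * D\<^sup>2 / (1 - p)) / (2 * ?B)"
      using at_average pos by (intro divide_right_mono) auto
    also have "\<dots> = (2 - p) * D\<^sup>2 / (?B * (1 - p))"
      by (simp add: mult.commute)
    finally show "ereal (Q_gap G K J (?a, ?c) z - perturbation t \<bullet> ((?a, ?c) - z))
        \<le> ereal ((2 - p) * D\<^sup>2 / (?B * (1 - p)))" by simp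
  qed

  have "norm (x 1 - x (t + 1)) \<le> norm (xhat - x 1) + norm (xhat - x (t + 1))"
    using norm_triangle_ineq4[of "xhat - x (t + 1)" "xhat - x 1"] by simp
  then have "norm (x 1 - x (t + 1)) \<le> norm (xhat - x 1) + D"
    using near[of "t + 1"] by simp
  then have v1: "1 / ?B * norm (x 1 - x (t + 1)) \<le> 1 / ?B * (norm (xhat - x 1) + D)"
    using pos by (intro mult_left_mono) auto
  have "norm (y 1 - y (t + 1)) \<le> norm (yhat - y 1) + norm (yhat - y (t + 1))"
    using norm_triangle_ineq4[of "yhat - y (t + 1)" "yhat - y 1"] by simp
  then have "1 / (\<beta> t * \<tau> t) * norm (y 1 - y (t + 1))
      \<le> 1 / (\<beta> t * \<tau> t) * (norm (yhat - y 1) + norm (yhat - y (t + 1)))"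
    using pos by (intro mult_left_mono) auto
  also have "\<dots> = 1 / (\<beta> t * \<tau> t) * norm (yhat - y 1) + 1 / ?B * (\<kappa> * norm (yhat - y (t + 1)))"
  proof -
    have "1 / (\<beta> t * \<tau> t) = 1 / ?B * \<kappa>" using eta_eq[OF t] pos by (simp add: field_simps)
    then show ?thesis by (simp only: distrib_left mult.assoc)
  qed
  also have "\<dots> \<le> 1 / (\<beta> t * \<tau> t) * norm (yhat - y 1)
      + 1 / ?B * (sqrt (\<eta> 1 / (\<tau> 1 * (1 - p))) * D)"
    using neary pos by (intro add_left_mono mult_left_mono) auto
  finally have v2: "1 / (\<beta> t * \<tau> t) * norm (y 1 - y (t + 1))
      \<le> 1 / (\<beta> t * \<tau> t) * norm (yhat - y 1) + 1 / ?B * (sqrt (\<eta> 1 / (\<tau> 1 * (1 - p))) * D)" .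
  have "norm (x (t + 1) - x t) \<le> norm (xhat - x t) + norm (xhat - x (t + 1))"
    using norm_triangle_ineq4[of "xhat - x t" "xhat - x (t + 1)"] by simp
  then have "norm (x (t + 1) - x t) \<le> 2 * D"
    using near[of t] near[of "t + 1"] t by simp
  moreover have "0 \<le> L\<^sub>K"
    unfolding L\<^sub>K using linK by (intro onorm_pos_le) (simp add: linear_linear)
  ultimately have v3: "L\<^sub>K / \<beta> t * norm (x (t + 1) - x t) \<le> L\<^sub>K / \<beta> t * (2 * D)"
    using pos by (intro mult_left_mono) auto
  have "norm (perturbation t) \<le> 1 / ?B * (norm (xhat - x 1) + D)
      + (1 / (\<beta> t * \<tau> t) * norm (yhat - y 1) + 1 / ?B * (sqrt (\<eta> 1 / (\<tau> 1 * (1 - p))) * D))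
      + L\<^sub>K / \<beta> t * (2 * D)"
    using norm_perturbation_le[OF t] v1 v2 v3 by linarith
  also have "\<dots> = 1 / ?B * norm (xhat - x 1) + 1 / (\<beta> t * \<tau> t) * norm (yhat - y 1)
      + (1 / ?B * (1 + sqrt (\<eta> 1 / (\<tau> 1 * (1 - p)))) + 2 * L\<^sub>K / \<beta> t) * D"
    by (simp add: algebra_simps)
  finally show "\<exists>v. perturbed_gap X Y G K J (?a, ?c) v
        \<le> ereal ((2 - p) * D\<^sup>2 / (?B * (1 - p))) \<and>
      norm v \<le> 1 / ?B * norm (xhat - x 1) + 1 / (\<beta> t * \<tau> t) * norm (yhat - y 1)
        + (1 / ?B * (1 + sqrt (\<eta> 1 / (\<tau> 1 * (1 - p)))) + 2 * L\<^sub>K / \<beta> t) * D"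
    using gap by blast
qed

end
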